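(* Let $M$ be a Buffon set of $m$ segments of length $\ell=\ell(m)$, and let $p(M)$ be its number of intersection points. Then $\Pr[p(M)=0]\rightarrow 1$ as $m\rightarrow \infty$ if and only if $\ell=o(1/m)$.
   Context: A Buffon set $M=M(m,\ell)$ is a random set of $m$ line segments, each of length $\ell$, placed independently in the unit square, with centers chosen uniformly in the unit square and angles chosen uniformly at random. An intersection point of $M$ is a point lying on at least two segments of $M$. *)

theory Defs
  imports "HOL-Probability.Probability" "HOL-Library.Landau_Symbols"
begin

text \<open>
  The norm on \<^typ>\<open>real \<times> real\<close> is Euclidean, so \<open>(cos \<theta>, sin \<theta>)\<close> is a unit vector and
  the segment below has length \<open>L\<close>. Segments are not clipped: they may protrude from the unit square.
\<close>

definition segment :: "real \<Rightarrow> (real \<times> real) \<times> real \<Rightarrow> (real \<times> real) set" where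
  "segment L s = (case s of (c, \<theta>) \<Rightarrow>
     closed_segment (c - (L / 2) *\<^sub>R (cos \<theta>, sin \<theta>)) (c + (L / 2) *\<^sub>R (cos \<theta>, sin \<theta>)))"

definition placement :: "((real \<times> real) \<times> real) measure" where
  "placement = uniform_measure lborel ({0..1} \<times> {0..1}) \<Otimes>\<^sub>M uniform_measure lborel {0..<2 * pi}"

text \<open>
  A sample of a Buffon set \<open>M(m, L)\<close> is a family \<open>\<omega>\<close> of \<open>m\<close> placements, standing for the
  segments \<open>segment L (\<omega> i)\<close> with \<open>i < m\<close>.
\<close>

definition buffon :: "nat \<Rightarrow> (nat \<Rightarrow> (real \<times> real) \<times> real) measure" where
  "buffon m = (\<Pi>\<^sub>M i\<in>{..<m}. placement)"

definition intersection_points ::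
    "nat \<Rightarrow> real \<Rightarrow> (nat \<Rightarrow> (real \<times> real) \<times> real) \<Rightarrow> (real \<times> real) set" where
  "intersection_points m L \<omega> =
     {x. \<exists>i<m. \<exists>j<m. i \<noteq> j \<and> x \<in> segment L (\<omega> i) \<and> x \<in> segment L (\<omega> j)}"

text \<open>
  Overlapping collinear segments have infinitely many common points, for which \<^const>\<open>card\<close>
  would return \<open>0\<close>; hence the count is an extended natural number.
\<close>

definition num_intersection_points ::
    "nat \<Rightarrow> real \<Rightarrow> (nat \<Rightarrow> (real \<times> real) \<times> real) \<Rightarrow> enat" where
  "num_intersection_points m L \<omega> =
     (if finite (intersection_points m L \<omega>) then enat (card (intersection_points m L \<omega>)) else \<infinity>)"

lemma prob_space_placement: "prob_space placement"
proof -
  have sq: "emeasure (lborel :: (real \<times> real) measure) ({0..1} \<times> {0..1}) = 1"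
    by (simp add: lborel_prod[symmetric] lborel.emeasure_pair_measure_Times)
  interpret A: prob_space "uniform_measure lborel ({0..1} \<times> {0..1} :: (real \<times> real) set)"
    by (rule prob_space_uniform_measure) (simp_all add: sq)
  interpret B: prob_space "uniform_measure lborel {0..<2 * pi}"
    by (rule prob_space_uniform_measure) simp_all
  interpret pair_prob_space "uniform_measure lborel ({0..1} \<times> {0..1} :: (real \<times> real) set)"
    "uniform_measure lborel {0..<2 * pi}" ..
  show ?thesis
    unfolding placement_def by unfold_locales
qed

lemma prob_space_buffon: "prob_space (buffon m)"
  unfolding buffon_def by (intro prob_space_PiM prob_space_placement)

end

theory Submission imports Defs begin

text \<open>
  Two segments can meet only if their centers are within distance \<open>L\<close> in each coordinate, so a
  given pair meets with probability at most \<open>4 L\<^sup>2\<close>, even conditionally on one of the segments; it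
  does meet if the centers differ by at most \<open>L / 8\<close> in each coordinate and the directions differ by
  an angle in \<open>[\<pi>/6, 5\<pi>/6]\<close>, which has probability at least a constant times \<open>L\<^sup>2\<close>. With
  \<open>m (m - 1) / 2\<close> pairs, the union bound shows that \<open>m L \<rightarrow> 0\<close> suffices. Conversely, the event of
  an intersection is monotone in \<open>L\<close>, so one may shrink \<open>L\<close> to \<open>c / m\<close> with \<open>c\<close> small; any two
  distinct pairs meet simultaneously with probability at most \<open>(4 L\<^sup>2)\<^sup>2\<close>, so the second Bonferroni
  inequality bounds the probability of an intersection below by \<open>a c\<^sup>2 - b c\<^sup>4 > 0\<close>, uniformly in \<open>m\<close>.
\<close>

section \<open>Related pairs in an independent sample\<close>

lemma nn_integral_PiM_remove:
  assumes "prob_space M" "finite I" "k \<in> I"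
    and f: "f \<in> borel_measurable (PiM I (\<lambda>_. M))"
  shows "(\<integral>\<^sup>+\<omega>. f \<omega> \<partial>PiM I (\<lambda>_. M)) = (\<integral>\<^sup>+x. \<integral>\<^sup>+y. f (x(k := y)) \<partial>M \<partial>PiM (I - {k}) (\<lambda>_. M))"
proof -
  interpret prob_space M by fact
  interpret product_sigma_finite "\<lambda>_. M" ..
  have "insert k (I - {k}) = I"
    using assms by auto
  with product_nn_integral_insert[of "I - {k}" k f] assms show ?thesis
    by simp
qed

lemma fun_upd_in_space_PiM:
  assumes "k \<in> I" "x \<in> space (PiM (I - {k}) (\<lambda>_. M))" "y \<in> space M"
  shows "x(k := y) \<in> space (PiM I (\<lambda>_. M))"
  using assms by (auto simp: space_PiM PiE_iff extensional_def)

lemma pred_PiM_pair: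
  assumes R: "Measurable.pred (M \<Otimes>\<^sub>M M) (\<lambda>(s, t). R s t)" and "i \<in> I" "j \<in> I"
  shows "Measurable.pred (PiM I (\<lambda>_. M)) (\<lambda>\<omega>. R (\<omega> i) (\<omega> j))"
proof -
  have "Measurable.pred (PiM I (\<lambda>_. M)) (\<lambda>\<omega>. case (\<omega> i, \<omega> j) of (s, t) \<Rightarrow> R s t)"
    using assms(2,3) by (intro measurable_compose[OF _ R] measurable_Pair measurable_component_singleton)
  then show ?thesis
    by simp
qed

text \<open>With every coordinate except \<open>k\<close> frozen, \<open>Q\<close> is constant:
  integrating out coordinate \<open>k\<close> costs a factor of at most \<open>q\<close> where
  \<open>Q\<close> holds, and both sides vanish where it fails. A trivial \<open>Q\<close> bounds a
  single pair; taking for \<open>Q\<close> the relation on another pair that avoids \<open>k\<close>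
  makes the bounds multiply, even if the two pairs share an index.\<close>

lemma emeasure_PiM_conj_pair_le:
  assumes "prob_space M" "finite I" "j \<in> I" "k \<in> I" "j \<noteq> k"
    and R: "Measurable.pred (M \<Otimes>\<^sub>M M) (\<lambda>(s, t). R s t)"
    and Q: "Measurable.pred (PiM I (\<lambda>_. M)) Q"
    and Q_indep: "\<And>x y. Q (x(k := y)) \<longleftrightarrow> Q x"
    and le: "\<And>s. s \<in> space M \<Longrightarrow> emeasure M {t \<in> space M. R s t} \<le> q"
  defines "P \<equiv> PiM I (\<lambda>_. M)"
  shows "emeasure P {\<omega> \<in> space P. Q \<omega> \<and> R (\<omega> j) (\<omega> k)} \<le> q * emeasure P {\<omega> \<in> space P. Q \<omega>}"
proof -
  interpret prob_space M by fact
  note [measurable] = Q[folded P_def] R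
  have [measurable]: "Measurable.pred P (\<lambda>\<omega>. R (\<omega> j) (\<omega> k))"
    unfolding P_def using R assms(3,4) by (rule pred_PiM_pair)
  define A where "A = {\<omega> \<in> space P. Q \<omega> \<and> R (\<omega> j) (\<omega> k)}"
  define B where "B = {\<omega> \<in> space P. Q \<omega>}"
  have [measurable]: "A \<in> sets P" "B \<in> sets P"
    unfolding A_def B_def by measurable
  have "emeasure P A = (\<integral>\<^sup>+\<omega>. indicator A \<omega> \<partial>P)"
    by simp
  also have "\<dots> = (\<integral>\<^sup>+x. \<integral>\<^sup>+y. indicator A (x(k := y)) \<partial>M \<partial>PiM (I - {k}) (\<lambda>_. M))"
    unfolding P_def by (rule nn_integral_PiM_remove[OF assms(1,2,4)]) (simp add: P_def[symmetric])
  \<comment> \<open>The factor \<open>q\<close> stays inside the inner integral, next to the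
    indicator of \<open>B\<close>, so that the same iterated-integral formula reassembles the
    right-hand side.\<close>
  also have "\<dots> \<le> (\<integral>\<^sup>+x. \<integral>\<^sup>+y. q * indicator B (x(k := y)) \<partial>M \<partial>PiM (I - {k}) (\<lambda>_. M))"
  proof (rule nn_integral_mono)
    fix x assume x: "x \<in> space (PiM (I - {k}) (\<lambda>_. M))"
    have upd: "x(k := y) \<in> space P" if "y \<in> space M" for y
      using fun_upd_in_space_PiM[OF assms(4) x that] by (simp add: P_def)
    have xj: "x j \<in> space M"
      using x assms by (auto simp: space_PiM PiE_iff)
    show "(\<integral>\<^sup>+y. indicator A (x(k := y)) \<partial>M) \<le> (\<integral>\<^sup>+y. q * indicator B (x(k := y)) \<partial>M)"
    proof (cases "Q x")
      case True
      have "(\<integral>\<^sup>+y. indicator A (x(k := y)) \<partial>M) = (\<integral>\<^sup>+y. indicator {t \<in> space M. R (x j) t} y \<partial>M)"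
        using True upd assms(5) by (intro nn_integral_cong) (auto simp: A_def Q_indep indicator_def)
      also have "\<dots> = emeasure M {t \<in> space M. R (x j) t}"
      proof (rule nn_integral_indicator)
        have "Measurable.pred M (\<lambda>t. case (x j, t) of (s, t) \<Rightarrow> R s t)"
          using xj by (intro measurable_compose[OF _ R]) simp
        then show "{t \<in> space M. R (x j) t} \<in> sets M"
          by simp
      qed
      also have "\<dots> \<le> q"
        using le xj by blast
      also have "q = (\<integral>\<^sup>+y. q \<partial>M)"
        by (simp add: emeasure_space_1)
      also have "\<dots> = (\<integral>\<^sup>+y. q * indicator B (x(k := y)) \<partial>M)"
        using True upd by (intro nn_integral_cong) (auto simp: B_def Q_indep)
      finally show ?thesis .
    next
      case False
      then have "(\<integral>\<^sup>+y. indicator A (x(k := y)) \<partial>M) = (\<integral>\<^sup>+y. 0 \<partial>M)"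
        by (intro nn_integral_cong) (auto simp: A_def Q_indep)
      then show ?thesis
        by simp
    qed
  qed
  also have "\<dots> = (\<integral>\<^sup>+\<omega>. q * indicator B \<omega> \<partial>P)"
    unfolding P_def
    by (rule nn_integral_PiM_remove[OF assms(1,2,4), symmetric]) (simp add: P_def[symmetric])
  also have "\<dots> = q * emeasure P B"
    by (simp add: nn_integral_cmult)
  finally show ?thesis
    by (simp add: A_def B_def)
qed

text \<open>Given that coordinate \<open>j\<close> lies in \<open>S\<close>, the relation holds with
  probability at least \<open>p\<close> over coordinate \<open>k\<close>; and coordinate
  \<open>j\<close>, having law \<open>M\<close>, lies in \<open>S\<close> with probability
  \<open>emeasure M S\<close>. Thus a lower bound is required only for sections at points of
  \<open>S\<close>.\<close>

lemma emeasure_PiM_pair_ge: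
  assumes "prob_space M" "finite I" "j \<in> I" "k \<in> I" "j \<noteq> k"
    and R: "Measurable.pred (M \<Otimes>\<^sub>M M) (\<lambda>(s, t). R s t)"
    and S: "S \<in> sets M"
    and ge: "\<And>s. s \<in> S \<Longrightarrow> p \<le> emeasure M {t \<in> space M. R s t}"
  defines "P \<equiv> PiM I (\<lambda>_. M)"
  shows "p * emeasure M S \<le> emeasure P {\<omega> \<in> space P. R (\<omega> j) (\<omega> k)}"
proof -
  interpret prob_space M by fact
  note [measurable] = R S
  have [measurable]: "Measurable.pred P (\<lambda>\<omega>. R (\<omega> j) (\<omega> k))"
    unfolding P_def using R assms(3,4) by (rule pred_PiM_pair)
  define P' where "P' = PiM (I - {k}) (\<lambda>_. M)"
  define A where "A = {\<omega> \<in> space P. R (\<omega> j) (\<omega> k)}"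
  have [measurable]: "A \<in> sets P"
    unfolding A_def by measurable
  define g where "g s = (\<integral>\<^sup>+t. indicator {t \<in> space M. R s t} t \<partial>M)" for s
  have sec: "{t \<in> space M. R s t} \<in> sets M" if "s \<in> space M" for s
  proof -
    have "Measurable.pred M (\<lambda>t. case (s, t) of (s, t) \<Rightarrow> R s t)"
      using that by (intro measurable_compose[OF _ R]) simp
    then show ?thesis
      by simp
  qed
  have g_eq: "g s = emeasure M {t \<in> space M. R s t}" if "s \<in> space M" for s
    using sec[OF that] by (simp add: g_def)
  \<comment> \<open>Since \<open>j\<close> differs from \<open>k\<close>, coordinate
    \<open>j\<close> survives the removal of \<open>k\<close>, and its marginal law is
    \<open>M\<close>.\<close>
  have D: "distr P' M (\<lambda>x. x j) = M"
    unfolding P'_def using assms distr_PiM_component[of "I - {k}" "\<lambda>_. M" j] by simp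
  have g_meas: "g \<in> borel_measurable M"
  proof -
    have "(\<lambda>s. emeasure M (Pair s -` {z \<in> space (M \<Otimes>\<^sub>M M). case z of (s, t) \<Rightarrow> R s t})) \<in> borel_measurable M"
      by (rule measurable_emeasure_Pair) (use R in measurable)
    also have "?this \<longleftrightarrow> ?thesis"
      by (intro measurable_cong)
         (auto simp: g_eq space_pair_measure intro!: arg_cong[where f = "emeasure M"])
    finally show ?thesis .
  qed
  have "p * emeasure M S = (\<integral>\<^sup>+s. p * indicator S s \<partial>M)"
    by (simp add: nn_integral_cmult)
  also have "\<dots> \<le> (\<integral>\<^sup>+s. g s \<partial>M)"
    by (intro nn_integral_mono) (auto simp: g_eq indicator_def intro: ge)
  also have "\<dots> = (\<integral>\<^sup>+s. g s \<partial>distr P' M (\<lambda>x. x j))"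
    by (simp add: D)
  also have "\<dots> = (\<integral>\<^sup>+x. g (x j) \<partial>P')"
  proof (rule nn_integral_distr)
    show "(\<lambda>x. x j) \<in> measurable P' M"
      unfolding P'_def by (rule measurable_component_singleton) (use assms in auto)
  qed (use g_meas in \<open>simp add: D\<close>)
  also have "\<dots> = (\<integral>\<^sup>+x. \<integral>\<^sup>+y. indicator A (x(k := y)) \<partial>M \<partial>P')"
  proof (intro nn_integral_cong)
    fix x assume x: "x \<in> space P'"
    have upd: "x(k := y) \<in> space P" if "y \<in> space M" for y
      using fun_upd_in_space_PiM[OF assms(4) _ that] x by (simp add: P_def P'_def)
    show "g (x j) = (\<integral>\<^sup>+y. indicator A (x(k := y)) \<partial>M)"
      unfolding g_def using upd assms(5)
      by (intro nn_integral_cong) (auto simp: A_def indicator_def)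
  qed
  also have "\<dots> = (\<integral>\<^sup>+\<omega>. indicator A \<omega> \<partial>P)"
    unfolding P_def P'_def
    by (rule nn_integral_PiM_remove[OF assms(1,2,4), symmetric]) (simp add: P_def[symmetric])
  also have "\<dots> = emeasure P A"
    by simp
  finally show ?thesis
    by (simp add: A_def)
qed

section \<open>Bonferroni's inequality and unordered pairs of indices\<close>

text \<open>The double sum runs over ordered pairs, so each overlap is subtracted twice. This
  weakening of the second Bonferroni inequality costs only a constant and suits induction: a new set
  adds its own measure minus at most the sum of its overlaps with the old sets.\<close>

lemma (in finite_measure) bonferroni_lower:
  assumes "finite E" "\<And>e. e \<in> E \<Longrightarrow> A e \<in> sets M"
  shows "(\<Sum>e\<in>E. measure M (A e)) - (\<Sum>e\<in>E. \<Sum>f\<in>E - {e}. measure M (A e \<inter> A f)) \<le> measure M (\<Union>e\<in>E. A e)"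
  using assms
proof (induction E rule: finite_induct)
  case empty
  then show ?case by simp
next
  case (insert x F)
  let ?U = "\<Union>e\<in>F. A e"
  have U: "?U \<in> sets M" and x: "A x \<in> sets M"
    using insert by auto
  have "A x \<inter> ?U = (\<Union>e\<in>F. A x \<inter> A e)"
    by auto
  then have int: "measure M (A x \<inter> ?U) \<le> (\<Sum>f\<in>F. measure M (A x \<inter> A f))"
    using insert.hyps insert.prems by (simp only:) (intro finite_measure_subadditive_finite, auto)
  \<comment> \<open>The overlaps with \<open>x\<close> in second place are nonnegative, so they only
    enlarge the subtracted sum.\<close>
  have "(\<Sum>e\<in>F. \<Sum>f\<in>F - {e}. measure M (A e \<inter> A f)) \<le> (\<Sum>e\<in>F. \<Sum>f\<in>insert x F - {e}. measure M (A e \<inter> A f))"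
    using insert by (intro sum_mono sum_mono2) auto
  moreover have "insert x F - {x} = F"
    using insert by auto
  moreover have "measure M (A x \<union> ?U) = measure M (A x) + measure M ?U - measure M (A x \<inter> ?U)"
    using finite_measure_Union'[OF x U] finite_measure_Diff'[OF U x] by (simp add: Int_commute)
  ultimately show ?case
    using insert int by simp
qed

lemma card_pairs_below: "real (card (SIGMA j:{..<m}. {..<j})) = real m * (real m - 1) / 2"
proof -
  have "(\<Sum>j<m. real j) = real m * (real m - 1) / 2"
    by (induction m) (simp_all add: field_simps)
  then show ?thesis
    by simp
qed



text \<open>There are \<open>N\<close> unordered pairs. The upper bound is the union bound. The
  lower bound is \<open>bonferroni_lower\<close>: each pair is related with probability at least
  \<open>p * measure M S\<close>, and two distinct pairs are both related with probability at most
  \<open>q * q\<close>.\<close>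

lemma prob_ex_related_pair:
  fixes M :: "'a measure" and p q :: real and m :: nat
  assumes M: "prob_space M"
    and R: "Measurable.pred (M \<Otimes>\<^sub>M M) (\<lambda>(s, t). R s t)" and sym: "\<And>s t. R s t \<longleftrightarrow> R t s"
    and le: "\<And>s. s \<in> space M \<Longrightarrow> emeasure M {t \<in> space M. R s t} \<le> ennreal q" "0 \<le> q"
  defines "P \<equiv> PiM {..<m} (\<lambda>_. M)" and "N \<equiv> real m * (real m - 1) / 2"
  defines "H \<equiv> {\<omega> \<in> space P. \<exists>i<m. \<exists>j<m. i \<noteq> j \<and> R (\<omega> i) (\<omega> j)}"
  shows sets_ex_related_pair: "H \<in> sets P"
    and prob_ex_related_pair_le: "measure P H \<le> N * q"
    and prob_ex_related_pair_ge:
      "S \<in> sets M \<Longrightarrow> (\<And>s. s \<in> S \<Longrightarrow> ennreal p \<le> emeasure M {t \<in> space M. R s t}) \<Longrightarrow> 0 \<le> p \<Longrightarrow>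
       N * (p * measure M S) - N\<^sup>2 * q\<^sup>2 \<le> measure P H"
proof -
  interpret M: prob_space M by fact
  interpret P: prob_space P
    unfolding P_def by (intro prob_space_PiM M)
  \<comment> \<open>Each unordered pair occurs once, larger index first; symmetry of
    \<open>R\<close> makes this enough.\<close>
  define E where "E = (SIGMA j:{..<m}. {..<j})"
  define A where "A e = {\<omega> \<in> space P. R (\<omega> (fst e)) (\<omega> (snd e))}" for e :: "nat \<times> nat"
  have fin: "finite E" and N: "real (card E) = N"
    unfolding E_def N_def card_pairs_below by simp_all
  have E: "fst e < m" "snd e < m" "snd e < fst e" if "e \<in> E" for e
    using that by (auto simp: E_def)
  have pred: "Measurable.pred P (\<lambda>\<omega>. R (\<omega> i) (\<omega> j))" if "i < m" "j < m" for i j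
    unfolding P_def using R that by (intro pred_PiM_pair) auto
  have A [measurable]: "A e \<in> sets P" if "e \<in> E" for e
    using pred[of "fst e" "snd e"] E[OF that] unfolding A_def by simp
  have H: "H = (\<Union>e\<in>E. A e)"
  proof (intro set_eqI iffI)
    fix \<omega> assume "\<omega> \<in> H"
    then obtain i j where ij: "\<omega> \<in> space P" "i < m" "j < m" "i \<noteq> j" "R (\<omega> i) (\<omega> j)"
      by (auto simp: H_def)
    then have "\<omega> \<in> A (max i j, min i j)" "(max i j, min i j) \<in> E"
      using sym by (auto simp: A_def E_def max_def min_def)
    then show "\<omega> \<in> (\<Union>e\<in>E. A e)"
      by blast
  next
    fix \<omega> assume "\<omega> \<in> (\<Union>e\<in>E. A e)"
    then obtain e where "e \<in> E" "\<omega> \<in> A e"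
      by blast
    then show "\<omega> \<in> H"
      using E[of e] unfolding A_def H_def mem_Collect_eq by (metis less_irrefl)
  qed
  show "H \<in> sets P"
    unfolding H using fin A by blast
  have bound: "measure P {\<omega> \<in> space P. Q \<omega> \<and> R (\<omega> j) (\<omega> k)} \<le> q * measure P {\<omega> \<in> space P. Q \<omega>}"
    if "j < m" "k < m" "j \<noteq> k" "Measurable.pred P Q" "\<And>x y. Q (x(k := y)) \<longleftrightarrow> Q x" for j k Q
  proof -
    have "emeasure P {\<omega> \<in> space P. Q \<omega> \<and> R (\<omega> j) (\<omega> k)} \<le> ennreal q * emeasure P {\<omega> \<in> space P. Q \<omega>}"
      unfolding P_def using that M R le by (intro emeasure_PiM_conj_pair_le) (auto simp: P_def)
    then show ?thesis
      using \<open>0 \<le> q\<close> by (simp add: P.emeasure_eq_measure ennreal_mult[symmetric])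
  qed
  have single: "measure P (A e) \<le> q" if "e \<in> E" for e
    using bound[of "fst e" "snd e" "\<lambda>_. True"] E[OF that] by (simp add: A_def P.prob_space)
  have joint: "measure P (A e \<inter> A f) \<le> q\<^sup>2" if "e \<in> E" "f \<in> E" "e \<noteq> f" for e f
  proof -
    \<comment> \<open>Some endpoint of \<open>e\<close> is not an endpoint of \<open>f\<close>; integrate it out first.\<close>
    obtain j k where jk: "j < m" "k < m" "j \<noteq> k" "k \<noteq> fst f" "k \<noteq> snd f"
      and Ae: "A e = {\<omega> \<in> space P. R (\<omega> j) (\<omega> k)}"
    proof (cases "snd e \<noteq> fst f \<and> snd e \<noteq> snd f")
      case True
      then show ?thesis
        using that[of "fst e" "snd e"] E[OF \<open>e \<in> E\<close>] by (auto simp: A_def)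
    next
      case False
      \<comment> \<open>Both pairs list the larger index first, so sharing both endpoints would
        force \<open>e = f\<close>.\<close>
      then have "fst e \<noteq> fst f \<and> fst e \<noteq> snd f"
        using E[OF \<open>e \<in> E\<close>] E[OF \<open>f \<in> E\<close>] \<open>e \<noteq> f\<close> by (auto simp: prod_eq_iff)
      then show ?thesis
        using that[of "snd e" "fst e"] E[OF \<open>e \<in> E\<close>] sym by (auto simp: A_def)
    qed
    have "A e \<inter> A f = {\<omega> \<in> space P. R (\<omega> (fst f)) (\<omega> (snd f)) \<and> R (\<omega> j) (\<omega> k)}"
      unfolding Ae by (auto simp: A_def)
    then have "measure P (A e \<inter> A f) \<le> q * measure P (A f)"
      using bound[of j k "\<lambda>\<omega>. R (\<omega> (fst f)) (\<omega> (snd f))"] jk pred[of "fst f" "snd f"] E[OF \<open>f \<in> E\<close>]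
      by (simp add: A_def)
    also have "\<dots> \<le> q * q"
      using single[OF \<open>f \<in> E\<close>] \<open>0 \<le> q\<close> by (rule mult_left_mono)
    finally show ?thesis
      by (simp add: power2_eq_square)
  qed
  have "measure P H \<le> (\<Sum>e\<in>E. measure P (A e))"
    unfolding H using fin A by (intro P.finite_measure_subadditive_finite) auto
  also have "\<dots> \<le> (\<Sum>e\<in>E. q)"
    by (intro sum_mono single)
  finally show "measure P H \<le> N * q"
    by (simp add: N)
  assume S: "S \<in> sets M" and ge: "\<And>s. s \<in> S \<Longrightarrow> ennreal p \<le> emeasure M {t \<in> space M. R s t}" and "0 \<le> p"
  have "p * measure M S \<le> measure P (A e)" if "e \<in> E" for e
  proof -
    have "ennreal p * emeasure M S \<le> emeasure P (A e)"
      unfolding P_def A_def using E[OF that] M R S ge by (intro emeasure_PiM_pair_ge) auto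
    then show ?thesis
      using \<open>0 \<le> p\<close> by (simp add: P.emeasure_eq_measure M.emeasure_eq_measure ennreal_mult[symmetric])
  qed
  then have "(\<Sum>e\<in>E. p * measure M S) \<le> (\<Sum>e\<in>E. measure P (A e))"
    by (rule sum_mono)
  \<comment> \<open>Putting the diagonal back rounds the number of ordered pairs of distinct
    elements up to the square of \<open>N\<close>.\<close>
  moreover have "(\<Sum>e\<in>E. \<Sum>f\<in>E - {e}. measure P (A e \<inter> A f)) \<le> (\<Sum>e\<in>E. \<Sum>f\<in>E. q\<^sup>2)"
  proof (intro sum_mono)
    fix e assume "e \<in> E"
    then have "(\<Sum>f\<in>E - {e}. measure P (A e \<inter> A f)) \<le> (\<Sum>f\<in>E - {e}. q\<^sup>2)"
      by (intro sum_mono joint) auto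
    also have "\<dots> \<le> (\<Sum>f\<in>E. q\<^sup>2)"
      using fin by (intro sum_mono2) auto
    finally show "(\<Sum>f\<in>E - {e}. measure P (A e \<inter> A f)) \<le> (\<Sum>f\<in>E. q\<^sup>2)" .
  qed
  moreover have "(\<Sum>e\<in>E. \<Sum>f\<in>E. q\<^sup>2) = N\<^sup>2 * q\<^sup>2"
    by (simp add: N power2_eq_square)
  ultimately show "N * (p * measure M S) - N\<^sup>2 * q\<^sup>2 \<le> measure P H"
    using P.bonferroni_lower[of E A, OF fin A] unfolding H sum_constant N by linarith
qed

section \<open>Meeting segments\<close>

definition meet :: "real \<Rightarrow> (real \<times> real) \<times> real \<Rightarrow> (real \<times> real) \<times> real \<Rightarrow> bool" where
  "meet L s t \<longleftrightarrow> segment L s \<inter> segment L t \<noteq> {}"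

lemma meet_commute: "meet L s t \<longleftrightarrow> meet L t s"
  by (auto simp: meet_def)

text \<open>An infinite set of intersection points is counted as \<open>\<infinity>\<close>, so the
  count is 0 only for the empty set. This turns the event of the theorem into one about
  pairs.\<close>

lemma num_intersection_points_eq_0_iff:
  "num_intersection_points m L \<omega> = 0 \<longleftrightarrow> \<not> (\<exists>i<m. \<exists>j<m. i \<noteq> j \<and> meet L (\<omega> i) (\<omega> j))"
proof -
  have "num_intersection_points m L \<omega> = 0 \<longleftrightarrow> intersection_points m L \<omega> = {}"
    by (auto simp: num_intersection_points_def zero_enat_def)
  then show ?thesis
    by (auto simp: intersection_points_def meet_def)
qed

text \<open>Shifting the convex-combination weight by 1/2 measures position from the center and
  makes \<open>L\<close> a plain factor, which suits rescaling and solving for a crossing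
  point.\<close>

lemma in_segment_iff:
  "x \<in> segment L (c, \<theta>) \<longleftrightarrow> (\<exists>u\<in>{-1/2..1/2}. x = c + (u * L) *\<^sub>R (cos \<theta>, sin \<theta>))"
proof
  assume "x \<in> segment L (c, \<theta>)"
  then obtain v where v: "0 \<le> v" "v \<le> 1"
    and "x = (1 - v) *\<^sub>R (c - (L / 2) *\<^sub>R (cos \<theta>, sin \<theta>)) + v *\<^sub>R (c + (L / 2) *\<^sub>R (cos \<theta>, sin \<theta>))"
    by (auto simp: segment_def in_segment)
  then have "x = c + ((v - 1/2) * L) *\<^sub>R (cos \<theta>, sin \<theta>)"
    by (auto simp: prod_eq_iff field_simps)
  with v show "\<exists>u\<in>{-1/2..1/2}. x = c + (u * L) *\<^sub>R (cos \<theta>, sin \<theta>)"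
    by (intro bexI[of _ "v - 1/2"]) auto
next
  assume "\<exists>u\<in>{-1/2..1/2}. x = c + (u * L) *\<^sub>R (cos \<theta>, sin \<theta>)"
  then obtain u where u: "-1/2 \<le> u" "u \<le> 1/2" and x: "x = c + (u * L) *\<^sub>R (cos \<theta>, sin \<theta>)"
    by auto
  have "x = (1 - (u + 1/2)) *\<^sub>R (c - (L / 2) *\<^sub>R (cos \<theta>, sin \<theta>)) + (u + 1/2) *\<^sub>R (c + (L / 2) *\<^sub>R (cos \<theta>, sin \<theta>))"
    by (simp add: x prod_eq_iff algebra_simps add_divide_distrib diff_divide_distrib)
  with u show "x \<in> segment L (c, \<theta>)"
    unfolding segment_def in_segment prod.case by (intro exI[of _ "u + 1/2"]) auto
qed

lemma meet_iff:
  "meet L s t \<longleftrightarrow> (\<exists>u\<in>{-1/2..1/2}. \<exists>v\<in>{-1/2..1/2}.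
     fst s + (u * L) *\<^sub>R (cos (snd s), sin (snd s)) = fst t + (v * L) *\<^sub>R (cos (snd t), sin (snd t)))"
proof -
  define f where "f p u = fst p + (u * L) *\<^sub>R (cos (snd p), sin (snd p))" for p :: "(real \<times> real) \<times> real" and u
  have seg: "x \<in> segment L p \<longleftrightarrow> (\<exists>u\<in>{-1/2..1/2}. x = f p u)" for p x
    using in_segment_iff[of x L "fst p" "snd p"] unfolding f_def by simp
  have "meet L s t \<longleftrightarrow> (\<exists>x. x \<in> segment L s \<and> x \<in> segment L t)"
    by (auto simp: meet_def)
  also have "\<dots> \<longleftrightarrow> (\<exists>u\<in>{-1/2..1/2}. \<exists>v\<in>{-1/2..1/2}. f s u = f t v)"
    unfolding seg by metis
  finally show ?thesis
    by (simp only: f_def)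
qed

text \<open>Lengthening a segment about its center keeps all its points: parameter \<open>u\<close>
  at length \<open>K\<close> becomes \<open>u * (K / L)\<close> at length \<open>L\<close>. For
  \<open>L = 0\<close> both lengths vanish.\<close>

lemma meet_mono:
  assumes "meet K s t" "0 \<le> K" "K \<le> L"
  shows "meet L s t"
proof (cases "L = 0")
  case False
  with assms have L: "L > 0" "0 \<le> K / L" "K / L \<le> 1"
    by auto
  have scale: "u * (K / L) \<in> {-1/2..1/2}" if "u \<in> {-1/2..1/2}" for u
  proof -
    have "\<bar>u * (K / L)\<bar> \<le> (1/2) * 1"
      unfolding abs_mult using that L by (intro mult_mono) (auto simp: abs_le_iff simp del: abs_divide)
    then show ?thesis
      by (auto simp only: abs_le_iff atLeastAtMost_iff)
  qed
  from assms(1) obtain u v where uv: "u \<in> {-1/2..1/2}" "v \<in> {-1/2..1/2}"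
    "fst s + (u * K) *\<^sub>R (cos (snd s), sin (snd s)) = fst t + (v * K) *\<^sub>R (cos (snd t), sin (snd t))"
    by (auto simp: meet_iff)
  show ?thesis
    unfolding meet_iff
    by (rule bexI[OF _ scale[OF uv(1)]], rule bexI[OF _ scale[OF uv(2)]]) (use uv(3) L in simp)
qed (use assms in auto)

text \<open>The relation is the projection of a closed set along the compact square of parameters
  \<open>(u, v)\<close>. Closedness is what yields measurability of meeting.\<close>

lemma closed_meet: "closed {(s, t). meet L s t}"
proof -
  let ?f = "\<lambda>(u, s). fst s + (u * L) *\<^sub>R (cos (snd s), sin (snd s)) :: real \<times> real"
  let ?T = "{z. ?f (fst (fst z), fst (snd z)) = ?f (snd (fst z), snd (snd z))}"
  have "closed ?T"
    by (intro closed_Collect_eq) (auto intro!: continuous_intros)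
  then have "closed {y. \<exists>x. x \<in> {-1/2..1/2} \<times> {-1/2..1/2} \<and> (x, y) \<in> ?T}"
    by (intro closed_compact_projection compact_Times) auto
  also have "{y. \<exists>x. x \<in> {-1/2..1/2} \<times> {-1/2..1/2} \<and> (x, y) \<in> ?T} = {(s, t). meet L s t}"
    by (auto simp: meet_iff Bex_def) blast+
  finally show ?thesis .
qed

section \<open>Borel sets and boxes under the placement measure\<close>

lemma sets_placement [measurable_cong]: "sets placement = sets borel"
proof -
  have "sets placement = sets (borel \<Otimes>\<^sub>M borel :: ((real \<times> real) \<times> real) measure)"
    unfolding placement_def by (intro sets_pair_measure_cong) simp_all
  then show ?thesis
    unfolding borel_prod .
qed

lemma space_placement [simp]: "space placement = UNIV"
  using sets_eq_imp_space_eq[OF sets_placement] by simp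

lemma pred_meet: "Measurable.pred (placement \<Otimes>\<^sub>M placement) (\<lambda>(s, t). meet L s t)"
proof -
  have "sets (placement \<Otimes>\<^sub>M placement) = sets (borel \<Otimes>\<^sub>M borel :: (((real \<times> real) \<times> real) \<times> ((real \<times> real) \<times> real)) measure)"
    by (intro sets_pair_measure_cong sets_placement)
  then have "{(s, t). meet L s t} \<in> sets (placement \<Otimes>\<^sub>M placement)"
    using borel_closed[OF closed_meet] unfolding borel_prod by simp
  then show ?thesis
    by (simp add: pred_def space_pair_measure)
qed

text \<open>The unit square has area 1, so only the angular factor carries a normalization.\<close>

lemma emeasure_placement_box:
  fixes A B C :: "real set"
  assumes [measurable]: "A \<in> sets borel" "B \<in> sets borel" "C \<in> sets borel"
  shows "emeasure placement ((A \<times> B) \<times> C) =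
    emeasure lborel ({0..1} \<inter> A) * emeasure lborel ({0..1} \<inter> B) *
    (emeasure lborel ({0..<2 * pi} \<inter> C) / ennreal (2 * pi))"
proof -
  have sq: "emeasure (lborel :: (real \<times> real) measure) (X \<times> Y) = emeasure lborel X * emeasure lborel Y"
    if "X \<in> sets borel" "Y \<in> sets borel" for X Y :: "real set"
    using that by (simp add: lborel_prod[symmetric] lborel.emeasure_pair_measure_Times)
  interpret B: prob_space "uniform_measure lborel {0..<2 * pi}"
    by (rule prob_space_uniform_measure) simp_all
  have "A \<times> B \<in> sets (borel \<Otimes>\<^sub>M borel)" "{0..1} \<times> {0..1} \<in> sets (borel \<Otimes>\<^sub>M borel :: (real \<times> real) measure)"
    by (auto intro: pair_measureI)
  then have [measurable]: "A \<times> B \<in> sets borel" "{0..1} \<times> {0..1} \<in> sets (borel :: (real \<times> real) measure)"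
    unfolding borel_prod .
  have Int: "({0..1} \<times> {0..1}) \<inter> (A \<times> B) = ({0..1} \<inter> A) \<times> ({0..1} \<inter> B)"
    by auto
  show ?thesis
    unfolding placement_def
    by (subst B.emeasure_pair_measure_Times) (simp_all add: Int sq divide_ennreal_def)
qed

section \<open>Probability of meeting a given segment\<close>

text \<open>In each coordinate a common point is within \<open>L / 2\<close> of both
  centers.\<close>

lemma meet_imp_close:
  assumes "meet L s t" "0 \<le> L"
  shows "\<bar>fst (fst t) - fst (fst s)\<bar> \<le> L" "\<bar>snd (fst t) - snd (fst s)\<bar> \<le> L"
proof -
  from assms(1) obtain u v where uv: "u \<in> {-1/2..1/2}" "v \<in> {-1/2..1/2}"
    and eq: "fst s + (u * L) *\<^sub>R (cos (snd s), sin (snd s)) = fst t + (v * L) *\<^sub>R (cos (snd t), sin (snd t))"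
    by (auto simp: meet_iff)
  have bnd: "\<bar>w * L * a\<bar> \<le> L / 2" if "w \<in> {-1/2..1/2}" "\<bar>a\<bar> \<le> 1" for w a
  proof -
    have "\<bar>w\<bar> * L * \<bar>a\<bar> \<le> 1/2 * L * 1"
      using that assms(2) by (intro mult_mono) auto
    then show ?thesis
      using assms(2) by (simp add: abs_mult)
  qed
  have "fst (fst t) - fst (fst s) = u * L * cos (snd s) - v * L * cos (snd t)"
    and "snd (fst t) - snd (fst s) = u * L * sin (snd s) - v * L * sin (snd t)"
    using eq by (auto simp: prod_eq_iff)
  then show "\<bar>fst (fst t) - fst (fst s)\<bar> \<le> L" "\<bar>snd (fst t) - snd (fst s)\<bar> \<le> L"
    using bnd[OF uv(1), of "cos (snd s)"] bnd[OF uv(2), of "cos (snd t)"]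
      bnd[OF uv(1), of "sin (snd s)"] bnd[OF uv(2), of "sin (snd t)"] by auto
qed

text \<open>The center of \<open>t\<close> must lie in a square of side \<open>2 * L\<close> around
  that of \<open>s\<close>, whatever the angles. The bound is uniform in \<open>s\<close>, as
  conditioning on one segment requires.\<close>

lemma emeasure_meet_le:
  assumes "0 \<le> L"
  shows "emeasure placement {t \<in> space placement. meet L s t} \<le> ennreal (4 * L\<^sup>2)"
proof -
  obtain x y \<theta> where s: "s = ((x, y), \<theta>)"
    by (metis prod.exhaust)
  have len: "emeasure lborel ({0..1} \<inter> {a - L..a + L}) \<le> ennreal (2 * L)" for a
  proof -
    have "emeasure lborel ({0..1} \<inter> {a - L..a + L}) \<le> emeasure lborel {a - L..a + L}"
      by (intro emeasure_mono) auto
    then show ?thesis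
      using assms by simp
  qed
  have box: "({x - L..x + L} \<times> {y - L..y + L}) \<times> (UNIV :: real set) \<in> sets placement"
    unfolding sets_placement by (intro borel_closed closed_Times) auto
  have "emeasure placement {t \<in> space placement. meet L s t}
      \<le> emeasure placement (({x - L..x + L} \<times> {y - L..y + L}) \<times> UNIV)"
  proof (rule emeasure_mono[OF _ box], safe)
    fix a b \<phi> assume "meet L s ((a, b), \<phi>)"
    from meet_imp_close[OF this assms] show "a \<in> {x - L..x + L}" "b \<in> {y - L..y + L}"
      by (auto simp: s)
  qed simp
  also have "\<dots> = emeasure lborel ({0..1} \<inter> {x - L..x + L}) * emeasure lborel ({0..1} \<inter> {y - L..y + L}) *
      (emeasure lborel ({0..<2 * pi} \<inter> UNIV) / ennreal (2 * pi))"
    by (rule emeasure_placement_box) simp_all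
  also have "\<dots> \<le> ennreal (2 * L) * ennreal (2 * L) * 1"
    by (intro mult_mono len) (simp_all add: ennreal_divide_self)
  also have "\<dots> = ennreal (4 * L\<^sup>2)"
    using assms by (simp add: ennreal_mult[symmetric] power2_eq_square)
  finally show ?thesis .
qed

text \<open>The parameters of the crossing point of the two lines solve a 2 by 2 linear system whose
  determinant is, up to sign, the sine of the angle between the directions. If that sine is not
  small and the centers are close, both parameters stay within the segments.\<close>

lemma meet_if_crossing:
  assumes "0 < L" and x: "\<bar>fst (fst t) - fst (fst s)\<bar> \<le> L / 8" and y: "\<bar>snd (fst t) - snd (fst s)\<bar> \<le> L / 8"
    and sin: "1 / 2 \<le> sin (snd t - snd s)"
  shows "meet L s t"
proof -
  define a b where "a = (fst (fst t) - fst (fst s)) / L" and "b = (snd (fst t) - snd (fst s)) / L"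
  define D where "D = sin (snd t - snd s)"
  \<comment> \<open>Cramer's rule, with the displacement \<open>(a, b)\<close> of the centers in
    units of \<open>L\<close>.\<close>
  define u where "u = (a * sin (snd t) - b * cos (snd t)) / D"
  define v where "v = (a * sin (snd s) - b * cos (snd s)) / D"
  have D: "1 / 2 \<le> D"
    using sin by (simp add: D_def)
  have ab: "\<bar>a\<bar> \<le> 1/8" "\<bar>b\<bar> \<le> 1/8"
    using x y \<open>0 < L\<close> by (auto simp: a_def b_def field_simps)
  \<comment> \<open>The numerator is at most 1/8 + 1/8 = 1/4 in absolute value, and \<open>D\<close>
    is at least 1/2.\<close>
  have bnd: "(a * sin \<theta> - b * cos \<theta>) / D \<in> {-1/2..1/2}" for \<theta>
  proof -
    have "\<bar>a * sin \<theta>\<bar> \<le> 1/8 * 1" "\<bar>b * cos \<theta>\<bar> \<le> 1/8 * 1"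
      unfolding abs_mult using ab by (intro mult_mono; simp)+
    then have "\<bar>a * sin \<theta> - b * cos \<theta>\<bar> \<le> 1/2 * D"
      using D by linarith
    then have "\<bar>(a * sin \<theta> - b * cos \<theta>) / D\<bar> \<le> 1/2"
      using D by (simp add: abs_divide pos_divide_le_eq)
    then show ?thesis
      by (auto simp only: abs_le_iff atLeastAtMost_iff)
  qed
  have DE: "D = sin (snd t) * cos (snd s) - cos (snd t) * sin (snd s)"
    by (simp add: D_def sin_diff)
  have "u * D = a * sin (snd t) - b * cos (snd t)" "v * D = a * sin (snd s) - b * cos (snd s)"
    using D by (auto simp: u_def v_def)
  then have "(u * cos (snd s) - v * cos (snd t)) * D = a * D" "(u * sin (snd s) - v * sin (snd t)) * D = b * D"
    unfolding DE by algebra+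
  then have "u * cos (snd s) - v * cos (snd t) = a" "u * sin (snd s) - v * sin (snd t) = b"
    using D by auto
  then have "L * (u * cos (snd s) - v * cos (snd t)) = L * a" "L * (u * sin (snd s) - v * sin (snd t)) = L * b"
    by simp_all
  moreover have "L * a = fst (fst t) - fst (fst s)" "L * b = snd (fst t) - snd (fst s)"
    using \<open>0 < L\<close> by (simp_all add: a_def b_def)
  ultimately have "fst s + (u * L) *\<^sub>R (cos (snd s), sin (snd s)) = fst t + (v * L) *\<^sub>R (cos (snd t), sin (snd t))"
    by (simp add: prod_eq_iff algebra_simps)
  moreover have "u \<in> {-1/2..1/2}" "v \<in> {-1/2..1/2}"
    unfolding u_def v_def by (rule bnd)+
  ultimately show ?thesis
    unfolding meet_iff by (intro bexI)
qed

text \<open>Up to \<open>pi / 2\<close> the sine increases from its value 1/2 at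
  \<open>pi / 6\<close>; beyond, reflect to \<open>pi - x\<close>.\<close>

lemma sin_ge_half:
  assumes "pi / 6 \<le> x" "x \<le> 5 * pi / 6"
  shows "1 / 2 \<le> sin x"
proof (cases "x \<le> pi / 2")
  case True
  then have "sin (pi / 6) \<le> sin x"
    using assms by (intro sin_monotone_2pi_le) auto
  then show ?thesis
    by (simp add: sin_30)
next
  case False
  then have "sin (pi / 6) \<le> sin (pi - x)"
    using assms by (intro sin_monotone_2pi_le) auto
  then show ?thesis
    by (simp add: sin_30)
qed

text \<open>Directions of \<open>t\<close> in \<open>{pi / 2..2 * pi / 3}\<close> make an angle
  between \<open>pi / 3\<close> and \<open>2 * pi / 3\<close> with that of \<open>s\<close>, with no
  wrap-around modulo \<open>2 * pi\<close>. They have probability 1/12, and each coordinate of the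
  center contributes a factor \<open>L / 8\<close>.\<close>

lemma emeasure_meet_ge:
  assumes L: "0 < L" "L \<le> 1" and s: "s \<in> ({0..1} \<times> {0..1}) \<times> {0..pi / 6}"
  shows "ennreal (L\<^sup>2 / 768) \<le> emeasure placement {t \<in> space placement. meet L s t}"
proof -
  obtain x y \<theta> where s_eq: "s = ((x, y), \<theta>)"
    by (metis prod.exhaust)
  have xy: "x \<in> {0..1}" "y \<in> {0..1}" and \<theta>: "\<theta> \<in> {0..pi / 6}"
    using s by (auto simp: s_eq)
  \<comment> \<open>Even for \<open>a\<close> at the border, half of the interval of length
    \<open>L / 4\<close> lies in the unit interval, because \<open>L \<le> 1\<close>.\<close>
  have len: "ennreal (L / 8) \<le> emeasure lborel ({0..1} \<inter> {a - L / 8..a + L / 8})" if "a \<in> {0..1}" for a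
    using that L by (auto simp: max_def min_def intro!: ennreal_leI)
  have "{0..<2 * pi} \<inter> {pi / 2..2 * pi / 3} = {pi / 2..2 * pi / 3}"
    by (intro Int_absorb1 subsetI, unfold atLeastAtMost_iff atLeastLessThan_iff) (use pi_gt_zero in linarith)
  then have ang: "emeasure lborel ({0..<2 * pi} \<inter> {pi / 2..2 * pi / 3}) / ennreal (2 * pi) = ennreal (1 / 12)"
    using pi_gt_zero by (simp add: divide_ennreal field_simps)
  have "ennreal (L\<^sup>2 / 768) = ennreal (L / 8) * ennreal (L / 8) * ennreal (1 / 12)"
    using L by (simp add: ennreal_mult[symmetric] power2_eq_square)
  also have "\<dots> \<le> emeasure lborel ({0..1} \<inter> {x - L / 8..x + L / 8}) *
      emeasure lborel ({0..1} \<inter> {y - L / 8..y + L / 8}) * ennreal (1 / 12)"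
    by (intro mult_mono len xy) simp_all
  also have "\<dots> = emeasure placement (({x - L / 8..x + L / 8} \<times> {y - L / 8..y + L / 8}) \<times> {pi / 2..2 * pi / 3})"
    unfolding ang[symmetric] by (rule emeasure_placement_box[symmetric]) simp_all
  also have "\<dots> \<le> emeasure placement {t \<in> space placement. meet L s t}"
  proof (rule emeasure_mono)
    show "({x - L / 8..x + L / 8} \<times> {y - L / 8..y + L / 8}) \<times> {pi / 2..2 * pi / 3} \<subseteq> {t \<in> space placement. meet L s t}"
    proof safe
      fix a b \<phi> assume *: "a \<in> {x - L / 8..x + L / 8}" "b \<in> {y - L / 8..y + L / 8}" "\<phi> \<in> {pi / 2..2 * pi / 3}"
      show "meet L s ((a, b), \<phi>)"
      proof (rule meet_if_crossing)
        have "pi / 6 \<le> \<phi> - \<theta>" "\<phi> - \<theta> \<le> 5 * pi / 6"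
          using * \<theta> pi_gt_zero by auto
        then show "1 / 2 \<le> sin (snd ((a, b), \<phi>) - snd s)"
          unfolding s_eq snd_conv by (rule sin_ge_half)
      qed (use L * in \<open>simp_all only: s_eq fst_conv snd_conv atLeastAtMost_iff abs_le_iff, linarith+\<close>)
    qed simp
    show "{t \<in> space placement. meet L s t} \<in> sets placement"
    proof -
      have "Measurable.pred placement (\<lambda>t. case (s, t) of (s, t) \<Rightarrow> meet L s t)"
        by (intro measurable_compose[OF _ pred_meet]) simp
      then show ?thesis
        by simp
    qed
  qed
  finally show ?thesis .
qed

text \<open>This is the set \<open>S\<close> of first placements in the lower bound; only its angle
  is restricted, to a twelfth of the circle.\<close>

lemma measure_placement_start: "measure placement (({0..1} \<times> {0..1}) \<times> {0..pi / 6}) = 1 / 12"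
proof -
  have "{0..<2 * pi} \<inter> {0..pi / 6} = {0..pi / 6}"
    by (intro Int_absorb1 subsetI, unfold atLeastAtMost_iff atLeastLessThan_iff) (use pi_gt_zero in linarith)
  then have "emeasure placement (({0..1} \<times> {0..1}) \<times> {0..pi / 6}) = ennreal (1 / 12)"
    using pi_gt_zero by (subst emeasure_placement_box) (simp_all add: divide_ennreal field_simps)
  then show ?thesis
    by (simp add: measure_def)
qed

section \<open>The threshold\<close>

lemma prob_no_intersection_eq:
  "measure (buffon m) {\<omega> \<in> space (buffon m). num_intersection_points m L \<omega> = 0} =
   1 - measure (buffon m) {\<omega> \<in> space (buffon m). \<exists>i<m. \<exists>j<m. i \<noteq> j \<and> meet L (\<omega> i) (\<omega> j)}"
  if "0 \<le> L"
proof -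
  interpret prob_space "buffon m"
    by (rule prob_space_buffon)
  let ?H = "{\<omega> \<in> space (buffon m). \<exists>i<m. \<exists>j<m. i \<noteq> j \<and> meet L (\<omega> i) (\<omega> j)}"
  have "?H \<in> sets (buffon m)"
    unfolding buffon_def
    by (rule sets_ex_related_pair[OF prob_space_placement pred_meet meet_commute emeasure_meet_le[OF that]]) simp
  moreover have "{\<omega> \<in> space (buffon m). num_intersection_points m L \<omega> = 0} = space (buffon m) - ?H"
    by (auto simp: num_intersection_points_eq_0_iff)
  ultimately show ?thesis
    by (simp only: prob_compl)
qed

text \<open>Fewer than half of \<open>m * m\<close> pairs when \<open>m > 0\<close>, each meeting
  with probability at most four times the square of \<open>L\<close>.\<close>

lemma prob_no_intersection_ge:
  assumes "0 \<le> L"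
  shows "1 - 2 * (real m * L)\<^sup>2 \<le>
    measure (buffon m) {\<omega> \<in> space (buffon m). num_intersection_points m L \<omega> = 0}"
proof -
  have "measure (buffon m) {\<omega> \<in> space (buffon m). \<exists>i<m. \<exists>j<m. i \<noteq> j \<and> meet L (\<omega> i) (\<omega> j)}
      \<le> real m * (real m - 1) / 2 * (4 * L\<^sup>2)"
    unfolding buffon_def
    by (rule prob_ex_related_pair_le[OF prob_space_placement pred_meet meet_commute emeasure_meet_le[OF assms]]) simp
  also have "\<dots> \<le> real m * real m / 2 * (4 * L\<^sup>2)"
    by (intro mult_right_mono divide_right_mono mult_left_mono) auto
  finally show ?thesis
    unfolding prob_no_intersection_eq[OF assms] by (simp add: power2_eq_square mult_ac)
qed

text \<open>For large \<open>L\<close> the Bonferroni bound may be negative, so it is applied at the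
  smaller length \<open>K = c / m\<close> and carried to \<open>L\<close> by monotonicity.\<close>

lemma prob_no_intersection_le:
  assumes m: "2 \<le> m" and c: "0 < c" "c \<le> 1 / 768" and L: "c / real m \<le> L"
  shows "measure (buffon m) {\<omega> \<in> space (buffon m). num_intersection_points m L \<omega> = 0} \<le> 1 - c\<^sup>2 / 49152"
proof -
  interpret prob_space "buffon m"
    by (rule prob_space_buffon)
  define K where "K = c / real m"
  define N where "N = real m * (real m - 1) / 2"
  have K: "0 < K" "K \<le> 1" "K \<le> L" and mK: "(real m)\<^sup>2 * K\<^sup>2 = c\<^sup>2"
    using m c L by (auto simp: K_def field_simps)
  let ?H = "\<lambda>L. {\<omega> \<in> space (buffon m). \<exists>i<m. \<exists>j<m. i \<noteq> j \<and> meet L (\<omega> i) (\<omega> j)}"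
  have box: "({0..1} \<times> {0..1}) \<times> {0..pi / 6} \<in> sets placement"
    unfolding sets_placement by (intro borel_closed closed_Times) auto
  have "N * (K\<^sup>2 / 768 * measure placement (({0..1} \<times> {0..1}) \<times> {0..pi / 6})) - N\<^sup>2 * (4 * K\<^sup>2)\<^sup>2 \<le> prob (?H K)"
    unfolding buffon_def N_def
    by (rule prob_ex_related_pair_ge[OF prob_space_placement pred_meet meet_commute emeasure_meet_le _ box emeasure_meet_ge])
       (use K in auto)
  also have "prob (?H K) \<le> prob (?H L)"
  proof (rule finite_measure_mono)
    show "?H K \<subseteq> ?H L"
      using K meet_mono[of K _ _ L] by fastforce
    show "?H L \<in> sets (buffon m)"
      unfolding buffon_def
      by (rule sets_ex_related_pair[OF prob_space_placement pred_meet meet_commute emeasure_meet_le]) (use K in auto)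
  qed
  \<comment> \<open>Here 9216 = 768 * 12, from the section bound and the measure of the starting
    set.\<close>
  finally have lower: "N * K\<^sup>2 / 9216 - 16 * (N * K\<^sup>2)\<^sup>2 \<le> prob (?H L)"
    by (simp add: measure_placement_start power_mult_distrib algebra_simps)
  \<comment> \<open>The lower estimate holds because \<open>m - 1\<close> is at least
    \<open>m / 2\<close> for \<open>m \<ge> 2\<close>.\<close>
  have "(real m)\<^sup>2 / 4 \<le> N" "N \<le> (real m)\<^sup>2 / 2"
    using m mult_right_mono[of 2 "real m" "real m"] by (auto simp: N_def power2_eq_square field_simps)
  then have "(real m)\<^sup>2 / 4 * K\<^sup>2 \<le> N * K\<^sup>2" "N * K\<^sup>2 \<le> (real m)\<^sup>2 / 2 * K\<^sup>2"
    by (simp_all only: mult_right_mono zero_le_power2)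
  then have NK: "c\<^sup>2 / 4 \<le> N * K\<^sup>2" "N * K\<^sup>2 \<le> c\<^sup>2 / 2"
    using mK by auto
  have "(N * K\<^sup>2)\<^sup>2 \<le> (c\<^sup>2 / 2)\<^sup>2"
    using NK c by (intro power_mono) (auto intro: order_trans[rotated])
  moreover have "c\<^sup>2 * c\<^sup>2 \<le> (1 / 768)\<^sup>2 * c\<^sup>2"
    using c by (intro mult_right_mono power_mono) auto
  ultimately have "16 * (N * K\<^sup>2)\<^sup>2 \<le> 4 * ((1 / 768)\<^sup>2 * c\<^sup>2)"
    by (simp add: power2_eq_square)
  \<comment> \<open>The main term is at least 1/36864 of the square of \<open>c\<close>. The cap
    1/768 on \<open>c\<close> keeps the error within a quarter of this, leaving three quarters,
    which is 1/49152.\<close>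
  then have "c\<^sup>2 / 49152 \<le> prob (?H L)"
    using lower NK(1) by (simp add: power2_eq_square)
  then show ?thesis
    using prob_no_intersection_eq[of L m] K by simp
qed

theorem theorem7:
  fixes l :: "nat \<Rightarrow> real"
  assumes "\<And>m. m \<ge> 1 \<Longrightarrow> l m > 0"
  shows "((\<lambda>m. measure (buffon m)
             {\<omega> \<in> space (buffon m). num_intersection_points m (l m) \<omega> = 0}) \<longlonglongrightarrow> 1)
         \<longleftrightarrow> l \<in> o(\<lambda>m. 1 / real m)"
proof
  assume lim: "(\<lambda>m. measure (buffon m)
             {\<omega> \<in> space (buffon m). num_intersection_points m (l m) \<omega> = 0}) \<longlonglongrightarrow> 1"
  show "l \<in> o(\<lambda>m. 1 / real m)"
  proof (rule landau_o.smallI)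
    fix c0 :: real assume "0 < c0"
    \<comment> \<open>The cap makes \<open>prob_no_intersection_le\<close> applicable, and a smaller
      constant proves a stronger bound on \<open>l\<close>.\<close>
    define c where "c = min c0 (1 / 768)"
    have c: "0 < c" "c \<le> 1 / 768" "c \<le> c0"
      using \<open>0 < c0\<close> by (auto simp: c_def)
    then have "1 - c\<^sup>2 / 49152 < 1"
      by simp
    \<comment> \<open>Eventually the probability exceeds \<open>1 - c\<^sup>2 / 49152\<close>, which
      rules out \<open>l m \<ge> c / m\<close> once there are two segments.\<close>
    from order_tendstoD(1)[OF lim this] eventually_ge_at_top[of 2]
    show "\<forall>\<^sub>F m in sequentially. norm (l m) \<le> c0 * norm (1 / real m)"
    proof eventually_elim
      case (elim m)
      then have "l m < c / real m"
        using prob_no_intersection_le[of m c "l m"] c by linarith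
      also have "\<dots> \<le> c0 / real m"
        using c by (intro divide_right_mono) auto
      finally show ?case
        using assms[of m] elim by simp
    qed
  qed
next
  assume "l \<in> o(\<lambda>m. 1 / real m)"
  from smalloD_tendsto[OF this] have "(\<lambda>m. real m * l m) \<longlonglongrightarrow> 0"
    by (simp add: mult.commute)
  then have "(\<lambda>m. 1 - 2 * (real m * l m)\<^sup>2) \<longlonglongrightarrow> 1 - 2 * 0\<^sup>2"
    by (intro tendsto_intros)
  then have lower: "(\<lambda>m. 1 - 2 * (real m * l m)\<^sup>2) \<longlonglongrightarrow> 1"
    by simp
  show "(\<lambda>m. measure (buffon m)
             {\<omega> \<in> space (buffon m). num_intersection_points m (l m) \<omega> = 0}) \<longlonglongrightarrow> 1"
  proof (rule tendsto_sandwich[OF _ _ lower tendsto_const])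
    show "\<forall>\<^sub>F m in sequentially. 1 - 2 * (real m * l m)\<^sup>2 \<le>
        measure (buffon m) {\<omega> \<in> space (buffon m). num_intersection_points m (l m) \<omega> = 0}"
      \<comment> \<open>Positivity of \<open>l m\<close> is assumed only from \<open>m = 1\<close>
        on.\<close>
      using eventually_ge_at_top[of 1]
      by eventually_elim (rule prob_no_intersection_ge[OF less_imp_le[OF assms]])
    show "\<forall>\<^sub>F m in sequentially.
        measure (buffon m) {\<omega> \<in> space (buffon m). num_intersection_points m (l m) \<omega> = 0} \<le> 1"
      by (simp add: prob_space.prob_le_1 prob_space_buffon)
  qed
qed

end
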